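(* Suppose that $V$ and $Z$ are two positive random variables and $\alpha>0$. Then $$\mathbb P(V>x)=\mathbb E\,e^{-x^\alpha Z}\quad\text{for all }x>0\qquad(1)$$ if and only if $$V\overset{\mathrm d}{=}T^{1/\alpha}/Z^{1/\alpha},\qquad(2)$$ where $T\sim\operatorname{Exp}(1)$ is independent of $Z$. If (1) or (2) holds, then $$\mathbb E\,V^s=\Gamma(s/\alpha+1)\,\mathbb E\,Z^{-s/\alpha},\qquad s>-\alpha.$$ In particular, if one of $Z$ and $V$ has moments of Gamma type, then so has the other.
   Context: $\overset{\mathrm d}{=}$ denotes equality in distribution. Moments are allowed to be $+\infty$. A positive random variable $X$ is said to have moments of Gamma type if there exist integers $J,K\ge0$ and real constants $C$, $D>0$, $a_j\ne0$, $b_j$ ($1\le j\le J$), $a'_k\neq0$, $b'_k$ ($1\le k\le K$) such that $$\mathbb E\,X^s=C D^s\,\frac{\prod_{j=1}^J\Gamma(a_js+b_j)}{\prod_{k=1}^K\Gamma(a'_ks+b'_k)}$$ for all real $s$ in some interval of positive length (the right-hand side being regarded as a meromorphic function of $s$, with removable singularities removed). *)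

theory Defs
  imports "HOL-Probability.Probability" "HOL-Complex_Analysis.Complex_Analysis"
begin

definition positive_random_variable :: "'a measure \<Rightarrow> ('a \<Rightarrow> real) \<Rightarrow> bool" where
  "positive_random_variable M X \<longleftrightarrow>
     prob_space M \<and> X \<in> borel_measurable M \<and> (AE \<omega> in M. 0 < X \<omega>)"

definition same_distribution ::
  "'a measure \<Rightarrow> ('a \<Rightarrow> real) \<Rightarrow> 'b measure \<Rightarrow> ('b \<Rightarrow> real) \<Rightarrow> bool" where
  "same_distribution M X N Y \<longleftrightarrow> distr M borel X = distr N borel Y"

definition moment :: "'a measure \<Rightarrow> ('a \<Rightarrow> real) \<Rightarrow> real \<Rightarrow> ennreal" where
  "moment M X s = (\<integral>\<^sup>+\<omega>. ennreal (X \<omega> powr s) \<partial>M)"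

text \<open>The condition is required on an open interval, which is no restriction since every interval
  of positive length contains one. \<^const>\<open>remove_sings\<close> gives the value of the limit at removable
  singularities, so what \<^const>\<open>Gamma\<close> and division return at poles is irrelevant; it gives \<open>0\<close> at
  genuine poles, and \<open>0\<close> is never a moment of a positive random variable.\<close>

definition moments_of_Gamma_type :: "'a measure \<Rightarrow> ('a \<Rightarrow> real) \<Rightarrow> bool" where
  "moments_of_Gamma_type M X \<longleftrightarrow>
     (\<exists>(J::nat) (K::nat) (C::real) (D::real) (a::nat \<Rightarrow> real) (b::nat \<Rightarrow> real)
        (a'::nat \<Rightarrow> real) (b'::nat \<Rightarrow> real).
        D > 0 \<and> (\<forall>j\<in>{1..J}. a j \<noteq> 0) \<and> (\<forall>k\<in>{1..K}. a' k \<noteq> 0) \<and>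
        (\<exists>l u. l < u \<and> (\<forall>s\<in>{l<..<u}.
           moment M X s < \<infinity> \<and>
           complex_of_real (enn2real (moment M X s)) =
             remove_sings
               (\<lambda>z. of_real C * of_real D powr z *
                  (\<Prod>j=1..J. Gamma (of_real (a j) * z + of_real (b j))) /
                  (\<Prod>k=1..K. Gamma (of_real (a' k) * z + of_real (b' k))))
               (of_real s))))"

text \<open>\<open>T \<sim> Exp(1)\<close> independent of (a copy of) \<open>Z\<close>. The space \<open>N\<close> on which \<open>Z\<close> is given need not
  carry such a \<open>T\<close>, so \<open>T\<close> lives on a space \<open>Q\<close> together with a copy \<open>Z'\<close> of \<open>Z\<close>; the case
  \<open>Q = N\<close>, \<open>Z' = Z\<close> is included, as are all extensions of \<open>N\<close>.\<close>

definition exp_independent_of ::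
  "'c measure \<Rightarrow> ('c \<Rightarrow> real) \<Rightarrow> ('c \<Rightarrow> real) \<Rightarrow> 'b measure \<Rightarrow> ('b \<Rightarrow> real) \<Rightarrow> bool" where
  "exp_independent_of Q T Z' N Z \<longleftrightarrow>
     prob_space Q \<and>
     distributed Q lborel T (exponential_density 1) \<and>
     Z' \<in> borel_measurable Q \<and> same_distribution Q Z' N Z \<and>
     prob_space.indep_var Q borel T borel Z'"

definition tail_is_Laplace ::
  "'a measure \<Rightarrow> ('a \<Rightarrow> real) \<Rightarrow> 'b measure \<Rightarrow> ('b \<Rightarrow> real) \<Rightarrow> real \<Rightarrow> bool" where
  "tail_is_Laplace M V N Z \<alpha> \<longleftrightarrow>
     (\<forall>x>0. measure M {\<omega> \<in> space M. V \<omega> > x} =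
       integral\<^sup>L N (\<lambda>\<omega>. exp (- (x powr \<alpha>) * Z \<omega>)))"

end

theory Submission
  imports Defs
begin

text \<open>Let \<open>T\<close> be exponential and independent of \<open>Z\<close>. Integrating out \<open>T\<close> first, the ratio
  \<open>T\<close> over \<open>Z\<close>, to the power \<open>1 / \<alpha>\<close>, exceeds \<open>x\<close> with probability \<open>E exp (- (x powr \<alpha>) * Z)\<close>, and tails
  determine a distribution; the moments factorise by independence.

  For moments of Gamma type, multiply or divide by the factor \<open>Gamma (s / \<alpha> + 1)\<close> and rescale. The
  given interval has to meet the range \<open>s > - \<alpha>\<close> of the moment formula. For \<open>V\<close> it lies inside that
  range, because all moments of order at most \<open>- \<alpha>\<close> are infinite. For \<open>Z\<close> it might consist of
  exponents \<open>\<ge> 1\<close> only; then the moments of \<open>Z\<close> are finite on the interval from \<open>0\<close> on, they are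
  analytic on the disc over it, and the identity theorem for meromorphic functions carries the
  formula down to exponents near \<open>0\<close>.\<close>

section \<open>The standard exponential law, its tails and its power moments\<close>

definition exp_law :: "real measure" where
  "exp_law = density lborel (\<lambda>t. ennreal (exponential_density 1 t))"

lemma sets_exp_law [simp, measurable_cong]: "sets exp_law = sets borel"
  by (simp add: exp_law_def)

lemma space_exp_law [simp]: "space exp_law = UNIV"
  by (simp add: exp_law_def)

lemma prob_space_exp_law: "prob_space exp_law"
  unfolding exp_law_def by (rule prob_space_exponential_density) simp

lemma AE_exp_law_pos: "AE t in exp_law. 0 < t"
proof -
  have "AE t in lborel. t \<noteq> (0::real)"
    by (rule AE_lborel_singleton)
  then show ?thesis
    unfolding exp_law_def
    by (subst AE_density) (auto simp: exponential_density_def)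
qed

text \<open>The density takes the shape of the integrand in
  \<open>Gamma_conv_nn_integral_real\<close>, so that Euler's integral can be read off
  directly.\<close>

lemma nn_integral_exp_law:
  assumes [measurable]: "f \<in> borel_measurable borel"
  shows "(\<integral>\<^sup>+t. f t \<partial>exp_law) = (\<integral>\<^sup>+t. ennreal (indicator {0..} t / exp t) * f t \<partial>lborel)"
  unfolding exp_law_def
  by (subst nn_integral_density)
     (auto intro!: nn_integral_cong simp: exponential_density_def indicator_def exp_minus field_simps)

lemma emeasure_exp_law_greaterThan:
  assumes "0 \<le> a"
  shows "emeasure exp_law {a<..} = ennreal (exp (- a))"
proof -
  interpret E: prob_space exp_law by (rule prob_space_exp_law)
  have "distributed exp_law lborel (\<lambda>t. t) (exponential_density 1)"
    unfolding distributed_def using sets_exp_law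
    by (auto simp: exp_law_def distr_id2 cong: measurable_cong_sets)
  from E.exponential_distributedD_gt[OF this assms]
  show ?thesis
    by (simp add: E.emeasure_eq_measure greaterThan_def)
qed

lemma nn_integral_exp_law_powr:
  assumes "p > -1"
  shows "(\<integral>\<^sup>+t. ennreal (t powr p) \<partial>exp_law) = ennreal (Gamma (p + 1))"
  using assms
  by (subst nn_integral_exp_law)
     (auto simp: Gamma_conv_nn_integral_real ennreal_mult'[symmetric] intro!: nn_integral_cong)

text \<open>If the integral had a finite value c, the pointwise bound of t powr (e - 1) by 1 + t
  powr p would give Gamma e \<le> 1 + c for all e in (0, 1]. This contradicts the pole of Gamma at
  0.\<close>

lemma nn_integral_exp_law_powr_top:
  assumes "p \<le> -1"
  shows "(\<integral>\<^sup>+t. ennreal (t powr p) \<partial>exp_law) = \<infinity>"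
proof (rule ccontr)
  assume "(\<integral>\<^sup>+t. ennreal (t powr p) \<partial>exp_law) \<noteq> \<infinity>"
  then obtain c where c: "(\<integral>\<^sup>+t. ennreal (t powr p) \<partial>exp_law) = ennreal c" "0 \<le> c"
    by (cases "\<integral>\<^sup>+t. ennreal (t powr p) \<partial>exp_law") auto
  interpret E: prob_space exp_law by (rule prob_space_exp_law)
  have bound: "Gamma e \<le> 1 + c" if e: "0 < e" "e \<le> 1" for e
  proof -
    have "ennreal (Gamma e) = (\<integral>\<^sup>+t. ennreal (t powr (e - 1)) \<partial>exp_law)"
      using nn_integral_exp_law_powr[of "e - 1"] e by simp
    also have "\<dots> \<le> (\<integral>\<^sup>+t. 1 + ennreal (t powr p) \<partial>exp_law)"
    proof (rule nn_integral_mono_AE)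
      show "AE t in exp_law. ennreal (t powr (e - 1)) \<le> 1 + ennreal (t powr p)"
        using AE_exp_law_pos
      proof eventually_elim
        case (elim t)
        have "t powr (e - 1) \<le> 1 + t powr p"
        proof (cases "t \<le> 1")
          case True
          then have "t powr (e - 1) \<le> t powr p"
            using elim e assms by (intro powr_mono') auto
          then show ?thesis by simp
        next
          case False
          then have "t powr (e - 1) \<le> t powr 0"
            using e by (intro powr_mono) auto
          then show ?thesis using False by (simp add: add_increasing2)
        qed
        then have "ennreal (t powr (e - 1)) \<le> ennreal (1 + t powr p)"
          by (rule ennreal_leI)
        then show ?case by simp
      qed
    qed
    also have "\<dots> = ennreal (1 + c)"
      using c E.emeasure_space_1 by (subst nn_integral_add) auto
    finally show ?thesis
      using c by (subst (asm) ennreal_le_iff) auto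
  qed
  have "filterlim Gamma at_infinity (at (0::real))"
    using Gamma_poles[of 0, where 'a = real] by simp
  then have "\<forall>\<^sub>F e in at 0. 1 + c < norm (Gamma (e::real))"
    by (intro filterlim_at_top_dense[THEN iffD1, rule_format] filterlim_at_infinity_imp_norm_at_top)
  then have "\<forall>\<^sub>F e in at_right 0. 1 + c < norm (Gamma (e::real))"
    by (simp add: eventually_at_split)
  moreover have "\<forall>\<^sub>F e in at_right (0::real). e \<in> {0<..<1}"
    by (rule eventually_at_right_real) simp
  ultimately have "\<forall>\<^sub>F e in at_right (0::real). False"
  proof eventually_elim
    case (elim e)
    then show ?case using bound[of e] Gamma_real_pos[of e] by simp
  qed
  then show False by simp
qed

section \<open>The law of the ratio, built from the law of the denominator\<close>

definition exp_ratio_law :: "real \<Rightarrow> real measure \<Rightarrow> real measure" where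
  "exp_ratio_law \<alpha> \<zeta> =
     distr (exp_law \<Otimes>\<^sub>M \<zeta>) borel (\<lambda>(t, z). t powr (1 / \<alpha>) / z powr (1 / \<alpha>))"

text \<open>Here \<zeta> stands for the law of Z. Working on the product of \<open>exp_law\<close>
  and \<zeta> makes tails and moments of the ratio available without any probability space that
  carries both T and Z.\<close>

locale positive_law =
  fixes \<zeta> :: "real measure" and \<alpha> :: real
  assumes real_distribution: "real_distribution \<zeta>"
    and AE_pos: "AE z in \<zeta>. 0 < z"
    and alpha_pos: "0 < \<alpha>"
begin

sublocale real_distribution \<zeta> by (rule real_distribution)
sublocale E: prob_space exp_law by (rule prob_space_exp_law)
sublocale P: pair_prob_space exp_law \<zeta> ..

lemma AE_pair_pos: "AE x in exp_law \<Otimes>\<^sub>M \<zeta>. 0 < fst x \<and> 0 < snd x"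
proof (rule AE_conjI)
  have "{x \<in> space (exp_law \<Otimes>\<^sub>M \<zeta>). 0 < fst x} \<in> sets (exp_law \<Otimes>\<^sub>M \<zeta>)"
    by measurable
  then show "AE x in exp_law \<Otimes>\<^sub>M \<zeta>. 0 < fst x"
    by (rule P.AE_pair_measure) (use AE_exp_law_pos in auto)
  have "{x \<in> space (exp_law \<Otimes>\<^sub>M \<zeta>). 0 < snd x} \<in> sets (exp_law \<Otimes>\<^sub>M \<zeta>)"
    by measurable
  then show "AE x in exp_law \<Otimes>\<^sub>M \<zeta>. 0 < snd x"
    by (rule P.AE_pair_measure) (use AE_pos in auto)
qed

lemma real_distribution_exp_ratio_law: "real_distribution (exp_ratio_law \<alpha> \<zeta>)"
  unfolding exp_ratio_law_def by (rule P.real_distribution_distr) measurable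

lemma AE_exp_ratio_law_pos: "AE y in exp_ratio_law \<alpha> \<zeta>. 0 < y"
  unfolding exp_ratio_law_def
  by (subst AE_distr_iff, (measurable)[2], rule eventually_mono[OF AE_pair_pos]) auto

lemma measure_exp_ratio_law_greaterThan:
  assumes "0 < x"
  shows "measure (exp_ratio_law \<alpha> \<zeta>) {x<..} = (\<integral>z. exp (- (x powr \<alpha>) * z) \<partial>\<zeta>)"
proof -
  let ?S = "{(t, z). x < t powr (1 / \<alpha>) / z powr (1 / \<alpha>)} :: (real \<times> real) set"
  have "{x \<in> space (exp_law \<Otimes>\<^sub>M \<zeta>). y < fst x powr (1 / \<alpha>) / snd x powr (1 / \<alpha>)} \<in> sets (exp_law \<Otimes>\<^sub>M \<zeta>)"
    for y by measurable
  from this[of x] have S: "?S \<in> sets (exp_law \<Otimes>\<^sub>M \<zeta>)"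
    by (simp add: space_pair_measure case_prod_unfold)
  have slice: "emeasure exp_law ((\<lambda>t. (t, z)) -` ?S) = ennreal (exp (- (x powr \<alpha>) * z))"
    if z: "0 < z" for z
  proof -
    \<comment> \<open>The two events are compared almost everywhere only, because the rules for
      powers used below need t > 0.\<close>
    have "AE t in exp_law. t \<in> (\<lambda>t. (t, z)) -` ?S \<longleftrightarrow> t \<in> {x powr \<alpha> * z <..}"
      using AE_exp_law_pos
    proof eventually_elim
      case (elim t)
      have "x < t powr (1 / \<alpha>) / z powr (1 / \<alpha>) \<longleftrightarrow> x < (t / z) powr (1 / \<alpha>)"
        using elim z by (simp add: powr_divide)
      also have "\<dots> \<longleftrightarrow> x powr \<alpha> < ((t / z) powr (1 / \<alpha>)) powr \<alpha>"
        using assms alpha_pos powr_less_mono2[of \<alpha> x "(t / z) powr (1 / \<alpha>)"]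
          powr_mono2[of \<alpha> "(t / z) powr (1 / \<alpha>)" x] by fastforce
      also have "\<dots> \<longleftrightarrow> x powr \<alpha> * z < t"
        using elim z alpha_pos by (simp add: powr_powr field_simps)
      finally show ?case by simp
    qed
    then have "emeasure exp_law ((\<lambda>t. (t, z)) -` ?S) = emeasure exp_law {x powr \<alpha> * z <..}"
      by (rule emeasure_eq_AE) (use S in \<open>auto simp: sets_exp_law intro!: sets_Pair2[OF S, simplified]\<close>)
    then show ?thesis
      using z by (simp add: emeasure_exp_law_greaterThan)
  qed
  have "emeasure (exp_ratio_law \<alpha> \<zeta>) {x<..} = emeasure (exp_law \<Otimes>\<^sub>M \<zeta>) ?S"
    unfolding exp_ratio_law_def
    by (subst emeasure_distr) (auto intro!: arg_cong[where f = "emeasure _"] simp: space_pair_measure)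
  also have "\<dots> = (\<integral>\<^sup>+z. emeasure exp_law ((\<lambda>t. (t, z)) -` ?S) \<partial>\<zeta>)"
    using S by (rule P.emeasure_pair_measure_alt2)
  also have "\<dots> = (\<integral>\<^sup>+z. ennreal (exp (- (x powr \<alpha>) * z)) \<partial>\<zeta>)"
    by (intro nn_integral_cong_AE eventually_mono[OF AE_pos] slice)
  finally have "emeasure (exp_ratio_law \<alpha> \<zeta>) {x<..} = (\<integral>\<^sup>+z. ennreal (exp (- (x powr \<alpha>) * z)) \<partial>\<zeta>)" .
  then show ?thesis
    by (subst integral_eq_nn_integral) (auto simp: measure_def)
qed

text \<open>Tonelli for nonnegative integrands allows every real s and infinite values. The same
  identity therefore yields the moment formula for s > - \<alpha> and the divergence for s \<le> -
  \<alpha>.\<close>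

lemma nn_integral_exp_ratio_law_powr:
  "(\<integral>\<^sup>+y. ennreal (y powr s) \<partial>exp_ratio_law \<alpha> \<zeta>) =
     (\<integral>\<^sup>+t. ennreal (t powr (s / \<alpha>)) \<partial>exp_law) * (\<integral>\<^sup>+z. ennreal (z powr (- s / \<alpha>)) \<partial>\<zeta>)"
proof -
  have "(\<integral>\<^sup>+y. ennreal (y powr s) \<partial>exp_ratio_law \<alpha> \<zeta>) =
      (\<integral>\<^sup>+x. ennreal ((fst x powr (1 / \<alpha>) / snd x powr (1 / \<alpha>)) powr s) \<partial>(exp_law \<Otimes>\<^sub>M \<zeta>))"
    unfolding exp_ratio_law_def by (subst nn_integral_distr) (auto simp: case_prod_beta)
  also have "\<dots> = (\<integral>\<^sup>+x. ennreal (fst x powr (s / \<alpha>)) * ennreal (snd x powr (- s / \<alpha>)) \<partial>(exp_law \<Otimes>\<^sub>M \<zeta>))"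
  proof (rule nn_integral_cong_AE)
    show "AE x in exp_law \<Otimes>\<^sub>M \<zeta>. ennreal ((fst x powr (1 / \<alpha>) / snd x powr (1 / \<alpha>)) powr s) =
        ennreal (fst x powr (s / \<alpha>)) * ennreal (snd x powr (- s / \<alpha>))"
      using AE_pair_pos
      by eventually_elim
         (simp add: powr_divide powr_powr powr_minus_divide ennreal_mult'[symmetric])
  qed
  also have "\<dots> = (\<integral>\<^sup>+t. \<integral>\<^sup>+z. ennreal (t powr (s / \<alpha>)) * ennreal (z powr (- s / \<alpha>)) \<partial>\<zeta> \<partial>exp_law)"
    by (subst nn_integral_fst[symmetric]) auto
  also have "\<dots> = (\<integral>\<^sup>+t. ennreal (t powr (s / \<alpha>)) \<partial>exp_law) * (\<integral>\<^sup>+z. ennreal (z powr (- s / \<alpha>)) \<partial>\<zeta>)"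
    by (simp add: nn_integral_cmult nn_integral_multc)
  finally show ?thesis .
qed

end

text \<open>Tails at x > 0 determine the distribution function there by complementation; at x \<le>
  0 positivity forces it to be 0.\<close>

lemma real_distribution_eqI_tails:
  assumes "real_distribution \<mu>" "real_distribution \<nu>"
    and "AE x in \<mu>. 0 < x" "AE x in \<nu>. 0 < x"
    and "\<And>x. 0 < x \<Longrightarrow> measure \<mu> {x<..} = measure \<nu> {x<..}"
  shows "\<mu> = \<nu>"
proof (rule cdf_unique)
  have tail: "cdf \<kappa> x = (if 0 < x then 1 - measure \<kappa> {x<..} else 0)"
    if "real_distribution \<kappa>" "AE x in \<kappa>. 0 < x" for \<kappa> :: "real measure" and x
  proof -
    interpret real_distribution \<kappa> by fact
    show ?thesis
    proof (cases "0 < x")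
      case True
      have "{..x} = space \<kappa> - {x<..}" by auto
      then show ?thesis
        using True prob_compl[of "{x<..}"] by (simp add: cdf_def)
    next
      case False
      then have "AE y in \<kappa>. y \<notin> {..x}"
        using that(2) by (auto elim!: eventually_mono)
      then show ?thesis
        using False prob_eq_0[of "{..x}"] by (simp add: cdf_def)
    qed
  qed
  show "cdf \<mu> = cdf \<nu>"
    using assms by (auto simp: tail)
qed fact+

section \<open>Removal of singularities and the identity theorem\<close>

lemma remove_sings_mult_analytic:
  assumes f: "f meromorphic_on {z}" and g: "g analytic_on {z}" "g z \<noteq> 0"
  shows "remove_sings (\<lambda>w. g w * f w) z = g z * remove_sings f z"
proof (cases "is_pole f z")
  case True
  have "(g \<longlongrightarrow> g z) (at z)"
    using g(1) analytic_at_imp_isCont isContD by blast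
  then have "is_pole (\<lambda>w. g w * f w) z"
    using tendsto_mult_filterlim_at_infinity g(2) True unfolding is_pole_def by blast
  \<comment> \<open>As g does not vanish at z it cannot cancel the pole, and
    \<open>remove_sings\<close> is 0 at a pole, so both sides are 0.\<close>
  then show ?thesis using True by simp
next
  case False
  have "not_essential f z"
    using f by (simp add: meromorphic_at_iff)
  then obtain c where c: "f \<midarrow>z\<rightarrow> c"
    using False by (auto simp: not_essential_def)
  have "(g \<longlongrightarrow> g z) (at z)"
    using g(1) analytic_at_imp_isCont isContD by blast
  from tendsto_mult[OF this c] have "remove_sings (\<lambda>w. g w * f w) z = g z * c"
    by (rule remove_sings_eqI)
  with c show ?thesis by (simp add: remove_sings_eqI)
qed

text \<open>Gamma is the reciprocal of the entire function \<open>rGamma\<close>, so f may run into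
  the poles of Gamma.\<close>

lemma meromorphic_on_Gamma' [meromorphic_intros]:
  fixes f :: "complex \<Rightarrow> complex"
  assumes "f analytic_on A"
  shows "(\<lambda>z. Gamma (f z)) meromorphic_on A"
proof -
  have "(\<lambda>z. inverse (rGamma (f z))) meromorphic_on A"
    by (intro meromorphic_on_inverse analytic_on_imp_meromorphic_on analytic_intros assms)
  then show ?thesis by (simp add: rGamma_inverse_Gamma)
qed

text \<open>Near z0, but off it, \<open>remove_sings F\<close> agrees with F, so the zeros of F - H
  accumulate at z0. On a connected open set a meromorphic function either avoids 0 off a sparse set
  or equals 0 off one; the first is excluded. Hence F = H in a punctured neighbourhood of every
  point of A, and H is analytic there.\<close>

lemma remove_sings_identity:
  assumes F: "F meromorphic_on A" and H: "H holomorphic_on A"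
    and A: "open A" "connected A" and z0: "z0 \<in> A"
    and freq: "\<exists>\<^sub>F z in at z0. remove_sings F z = H z"
    and z: "z \<in> A"
  shows "remove_sings F z = H z"
proof -
  have H': "H analytic_on A"
    using A(1) H by (simp add: analytic_on_open)
  have mero: "(\<lambda>z. F z - H z) meromorphic_on A"
    by (intro meromorphic_on_diff F analytic_on_imp_meromorphic_on H')
  have "isolated_singularity_at F z0"
    using z0 by (intro meromorphic_on_isolated_singularity meromorphic_on_subset[OF F]) simp
  then have "\<forall>\<^sub>F w in at z0. remove_sings F w = F w"
    by (rule eventually_remove_sings_eq_at)
  from frequently_eventually_frequently[OF freq this]
  have zero: "\<exists>\<^sub>F w in at z0. F w - H w = 0"
    by (rule frequently_elim1) (metis right_minus_eq)
  have "\<not> (\<forall>\<^sub>F w in cosparse A. F w - H w \<noteq> 0)"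
  proof
    assume "\<forall>\<^sub>F w in cosparse A. F w - H w \<noteq> 0"
    then have "\<forall>\<^sub>F w in at z0. F w - H w \<noteq> 0"
      using A(1) z0 by (simp only: eventually_cosparse_open_eq)
    with zero show False
      unfolding frequently_def by contradiction
  qed
  with meromorphic_imp_constant_or_avoid[OF mero A, of 0]
  have "\<forall>\<^sub>F w in cosparse A. F w - H w = 0"
    by satx
  then have "\<forall>\<^sub>F w in at z. F w - H w = 0"
    using A(1) z by (simp only: eventually_cosparse_open_eq)
  then have "remove_sings F z = remove_sings H z"
    by (intro remove_sings_cong) simp_all
  also have "\<dots> = H z"
    using z by (intro remove_sings_at_analytic analytic_on_subset[OF H']) simp
  finally show ?thesis .
qed

section \<open>Functions of Gamma type and their closure properties\<close>

definition Gamma_quotient ::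
  "nat \<Rightarrow> nat \<Rightarrow> real \<Rightarrow> real \<Rightarrow> (nat \<Rightarrow> real) \<Rightarrow> (nat \<Rightarrow> real) \<Rightarrow> (nat \<Rightarrow> real) \<Rightarrow> (nat \<Rightarrow> real)
    \<Rightarrow> complex \<Rightarrow> complex" where
  "Gamma_quotient J K C D a b a' b' =
     (\<lambda>z. of_real C * of_real D powr z *
        (\<Prod>j=1..J. Gamma (of_real (a j) * z + of_real (b j))) /
        (\<Prod>k=1..K. Gamma (of_real (a' k) * z + of_real (b' k))))"

lemma meromorphic_on_Gamma_quotient:
  assumes "D > 0"
  shows "Gamma_quotient J K C D a b a' b' meromorphic_on A"
proof -
  have "(\<lambda>z. of_real D powr z) analytic_on A"
    using assms by (simp add: powr_def analytic_intros)
  then show ?thesis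
    unfolding Gamma_quotient_def
    by (intro meromorphic_intros analytic_intros) (auto intro: analytic_on_imp_meromorphic_on)
qed

text \<open>Finiteness of moments is kept apart from the formula, so that the closure properties can
  be proved for arbitrary real functions.\<close>

definition Gamma_type_on :: "real set \<Rightarrow> (real \<Rightarrow> real) \<Rightarrow> bool" where
  "Gamma_type_on S f \<longleftrightarrow>
     (\<exists>J K C D a b a' b'. D > 0 \<and> (\<forall>j\<in>{1..J}. a j \<noteq> 0) \<and> (\<forall>k\<in>{1..K}. a' k \<noteq> 0) \<and>
        (\<forall>s\<in>S. of_real (f s) = remove_sings (Gamma_quotient J K C D a b a' b') (of_real s)))"

lemma Gamma_type_onI:
  assumes "D > 0" "\<And>j. j \<in> {1..J} \<Longrightarrow> a j \<noteq> 0" "\<And>k. k \<in> {1..K} \<Longrightarrow> a' k \<noteq> 0"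
    and "\<And>s. s \<in> S \<Longrightarrow> of_real (f s) = remove_sings (Gamma_quotient J K C D a b a' b') (of_real s)"
  shows "Gamma_type_on S f"
  using assms unfolding Gamma_type_on_def by blast

lemma moments_of_Gamma_type_iff:
  "moments_of_Gamma_type M X \<longleftrightarrow>
     (\<exists>l u. l < u \<and> (\<forall>s\<in>{l<..<u}. moment M X s < \<infinity>) \<and>
        Gamma_type_on {l<..<u} (\<lambda>s. enn2real (moment M X s)))"
  (is "_ \<longleftrightarrow> ?R")
proof
  assume "moments_of_Gamma_type M X"
  then show ?R
    unfolding moments_of_Gamma_type_def Gamma_quotient_def[symmetric]
  proof (elim exE conjE, goal_cases)
    case (1 J K C D a b a' b' l u)
    have "Gamma_type_on {l<..<u} (\<lambda>s. enn2real (moment M X s))"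
    proof (rule Gamma_type_onI)
      show "D > 0" by fact
      show "a j \<noteq> 0" if "j \<in> {1..J}" for j
        using 1(2) that by (rule bspec)
      show "a' k \<noteq> 0" if "k \<in> {1..K}" for k
        using 1(3) that by (rule bspec)
      show "of_real (enn2real (moment M X s)) = remove_sings (Gamma_quotient J K C D a b a' b') (of_real s)"
        if "s \<in> {l<..<u}" for s
        using bspec[OF 1(5) that] by (rule conjunct2)
    qed
    moreover have "\<forall>s\<in>{l<..<u}. moment M X s < \<infinity>"
      using 1(5) unfolding ball_conj_distrib by (rule conjunct1)
    ultimately show ?case
      using \<open>l < u\<close> by (intro exI[of _ l] exI[of _ u] conjI)
  qed
next
  assume ?R
  then show "moments_of_Gamma_type M X"
    unfolding Gamma_type_on_def
  proof (elim exE conjE, goal_cases)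
    case (1 l u J K C D a b a' b')
    have "\<forall>s\<in>{l<..<u}. moment M X s < \<infinity> \<and>
        of_real (enn2real (moment M X s)) = remove_sings (Gamma_quotient J K C D a b a' b') (of_real s)"
      unfolding ball_conj_distrib using 1(2,6) by (rule conjI)
    with 1(1,3-5) show ?case
      unfolding moments_of_Gamma_type_def Gamma_quotient_def[symmetric]
      by (intro exI[of _ J] exI[of _ K] exI[of _ C] exI[of _ D] exI[of _ a] exI[of _ b]
          exI[of _ a'] exI[of _ b'] exI[of _ l] exI[of _ u] conjI)
  qed
qed

lemma Gamma_type_on_cong:
  "(\<And>s. s \<in> S \<Longrightarrow> f s = g s) \<Longrightarrow> Gamma_type_on S f \<longleftrightarrow> Gamma_type_on S g"
  unfolding Gamma_type_on_def by simp

text \<open>The substitution of c * z for z turns D into D powr c and each coefficient of z into its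
  multiple by c, which stays nonzero; the shifts b and b' are unchanged.\<close>

lemma Gamma_type_on_scale:
  assumes "Gamma_type_on S f" and c: "c \<noteq> 0" and T: "\<And>s. s \<in> T \<Longrightarrow> c * s \<in> S"
  shows "Gamma_type_on T (\<lambda>s. f (c * s))"
proof -
  from assms(1) obtain J K C D a b a' b' where
    D: "D > 0" and a: "\<forall>j\<in>{1..J}. a j \<noteq> 0" "\<forall>k\<in>{1..K}. a' k \<noteq> 0" and
    f: "\<And>s. s \<in> S \<Longrightarrow> of_real (f s) = remove_sings (Gamma_quotient J K C D a b a' b') (of_real s)"
    unfolding Gamma_type_on_def by blast
  \<comment> \<open>Both bases are positive reals, so \<open>Ln\<close> is the real logarithm and no
    choice of branch interferes.\<close>
  have "of_real (D powr c) powr z = of_real D powr (of_real c * z)" for z :: complex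
    using D by (simp add: powr_def Ln_of_real ln_powr mult_ac flip: of_real_exp)
  then have "Gamma_quotient J K C (D powr c) (\<lambda>j. a j * c) b (\<lambda>k. a' k * c) b' =
      Gamma_quotient J K C D a b a' b' \<circ> (\<lambda>z. of_real c * z)"
    by (auto simp: Gamma_quotient_def fun_eq_iff mult_ac)
  \<comment> \<open>Multiplication by c maps punctured neighbourhoods onto punctured neighbourhoods,
    so \<open>remove_sings\<close> commutes with the substitution.\<close>
  moreover have "filtermap (\<lambda>z. of_real c * z) (at (of_real s)) = at (of_real (c * s) :: complex)" for s
  proof -
    have "bij (\<lambda>z::complex. of_real c * z)"
      using c by (intro o_bij[of "\<lambda>z. z / of_real c"]) auto
    then show ?thesis
      using c filtermap_linear_at_within[of "\<lambda>z::complex. of_real c * z" "of_real s" UNIV]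
      by (simp add: bij_is_surj open_times_image)
  qed
  ultimately have "\<forall>s\<in>T. of_real (f (c * s)) =
      remove_sings (Gamma_quotient J K C (D powr c) (\<lambda>j. a j * c) b (\<lambda>k. a' k * c) b') (of_real s)"
    using f T by (simp add: remove_sings_compose)
  then show ?thesis
    using D a c by (intro Gamma_type_onI) auto
qed

text \<open>The new Gamma factor is appended to the numerator or to the denominator. Since c * s + d
  > 0 on S, it is analytic and nonzero at these points and can be pulled out of
  \<open>remove_sings\<close>.\<close>

lemma
  assumes "Gamma_type_on S f" and c: "c \<noteq> 0" and S: "\<And>s. s \<in> S \<Longrightarrow> c * s + d > 0"
  shows Gamma_type_on_mult_Gamma: "Gamma_type_on S (\<lambda>s. Gamma (c * s + d) * f s)"
    and Gamma_type_on_divide_Gamma: "Gamma_type_on S (\<lambda>s. f s / Gamma (c * s + d))"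
proof -
  from assms(1) obtain J K C D a b a' b' where
    D: "D > 0" and a: "\<forall>j\<in>{1..J}. a j \<noteq> 0" "\<forall>k\<in>{1..K}. a' k \<noteq> 0" and
    f: "\<And>s. s \<in> S \<Longrightarrow> of_real (f s) = remove_sings (Gamma_quotient J K C D a b a' b') (of_real s)"
    unfolding Gamma_type_on_def by blast
  let ?F = "Gamma_quotient J K C D a b a' b'"
  let ?g = "\<lambda>z. Gamma (of_real c * z + of_real d) :: complex"
  have mero: "?F meromorphic_on {z}" for z
    using D by (rule meromorphic_on_Gamma_quotient)
  have nonpos: "complex_of_real c * of_real s + of_real d \<notin> \<int>\<^sub>\<le>\<^sub>0" if "s \<in> S" for s
  proof -
    have "0 < Re (of_real c * of_real s + of_real d)"
      using S[OF that] by simp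
    then show ?thesis
      by (metis nonpos_Ints_cases Re_complex_of_real of_real_of_int_eq of_int_le_0_iff not_le)
  qed
  have g: "?g analytic_on {of_real s}" "?g (of_real s) \<noteq> 0" "?g (of_real s) = of_real (Gamma (c * s + d))"
    if "s \<in> S" for s
  proof -
    show "?g analytic_on {of_real s}"
      using nonpos[OF that] by (intro analytic_intros) auto
    show "?g (of_real s) \<noteq> 0"
      using nonpos[OF that] by (simp add: Gamma_eq_zero_iff)
    show "?g (of_real s) = of_real (Gamma (c * s + d))"
      by (simp flip: Gamma_complex_of_real)
  qed
  \<comment> \<open>The new factor receives the index \<open>Suc n\<close>; updating there leaves
    the earlier factors alone.\<close>
  have prod_upd: "(\<Prod>j=1..Suc n. Gamma (of_real ((x(Suc n := c)) j) * z + of_real ((y(Suc n := d)) j))) =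
      ?g z * (\<Prod>j=1..n. Gamma (of_real (x j) * z + of_real (y j)))" for x y n z
    by (simp add: prod.nat_ivl_Suc' cong: prod.cong_simp)
  have eq: "Gamma_quotient (Suc J) K C D (a(Suc J := c)) (b(Suc J := d)) a' b' = (\<lambda>z. ?g z * ?F z)"
    "Gamma_quotient J (Suc K) C D a b (a'(Suc K := c)) (b'(Suc K := d)) = (\<lambda>z. inverse (?g z) * ?F z)"
    unfolding Gamma_quotient_def prod_upd by (simp_all add: fun_eq_iff divide_inverse mult_ac)
  show "Gamma_type_on S (\<lambda>s. Gamma (c * s + d) * f s)"
  proof (rule Gamma_type_onI)
    show "of_real (Gamma (c * s + d) * f s) =
        remove_sings (Gamma_quotient (Suc J) K C D (a(Suc J := c)) (b(Suc J := d)) a' b') (of_real s)"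
      if "s \<in> S" for s
      using g[OF that] unfolding eq remove_sings_mult_analytic[OF mero g(1,2)[OF that]]
      by (simp add: f[OF that])
  qed (use D a c in \<open>auto simp: le_Suc_eq\<close>)
  show "Gamma_type_on S (\<lambda>s. f s / Gamma (c * s + d))"
  proof (rule Gamma_type_onI)
    show "of_real (f s / Gamma (c * s + d)) =
        remove_sings (Gamma_quotient J (Suc K) C D a b (a'(Suc K := c)) (b'(Suc K := d))) (of_real s)"
      if "s \<in> S" for s
    proof -
      have "(\<lambda>z. inverse (?g z)) analytic_on {of_real s}"
        using g(1,2)[OF that] by (intro analytic_on_inverse) auto
      then have "remove_sings (\<lambda>z. inverse (?g z) * ?F z) (of_real s) =
          inverse (?g (of_real s)) * remove_sings ?F (of_real s)"
        using g(2)[OF that] by (intro remove_sings_mult_analytic mero) auto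
      then show ?thesis
        unfolding eq g(3)[OF that] f[OF that, symmetric] by (simp add: divide_inverse)
    qed
  qed (use D a c in \<open>auto simp: le_Suc_eq\<close>)
qed

text \<open>This is the continuation step: the holomorphic H agrees with the Gamma quotient on a
  short real interval, hence on the whole disc, and so the formula holds with the same parameters on
  the whole diameter.\<close>

lemma Gamma_type_on_ball:
  assumes "Gamma_type_on {l<..<u} f" "l < u" and H: "H holomorphic_on ball (of_real c) r"
    and f: "\<And>s. s \<in> {c - r<..<c + r} \<Longrightarrow> H (of_real s) = of_real (f s)"
    and sub: "{l<..<u} \<subseteq> {c - r<..<c + r}"
  shows "Gamma_type_on {c - r<..<c + r} f"
proof -
  from assms(1) obtain J K C D a b a' b' where
    D: "D > 0" and a: "\<forall>j\<in>{1..J}. a j \<noteq> 0" "\<forall>k\<in>{1..K}. a' k \<noteq> 0" and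
    eq: "\<And>s. s \<in> {l<..<u} \<Longrightarrow> of_real (f s) = remove_sings (Gamma_quotient J K C D a b a' b') (of_real s)"
    unfolding Gamma_type_on_def by blast
  have ball: "complex_of_real s \<in> ball (of_real c) r \<longleftrightarrow> s \<in> {c - r<..<c + r}" for s
    by (auto simp: dist_real_def dist_complex_def abs_less_iff simp flip: of_real_diff)
  define m where "m = (l + u) / 2"
  have m: "m \<in> {l<..<u}" using assms(2) by (auto simp: m_def)
  have "\<forall>\<^sub>F s in at m. s \<in> {l<..<u}"
    using m by (intro eventually_at_in_open') auto
  then have "\<exists>\<^sub>F s in at m. s \<in> {l<..<u}"
    by (intro eventually_frequently) auto
  then have "\<exists>\<^sub>F s in at m. remove_sings (Gamma_quotient J K C D a b a' b') (of_real s) = H (of_real s)"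
    by (rule frequently_elim1) (use eq f sub in auto)
  \<comment> \<open>This carries the accumulation of real points at the midpoint m over to the
    complex plane, where the identity theorem needs it.\<close>
  moreover have "filterlim complex_of_real (at (of_real m)) (at m)"
    by (auto simp: filterlim_at eventually_at_filter intro!: tendsto_intros)
  ultimately have "\<exists>\<^sub>F z in at (of_real m). remove_sings (Gamma_quotient J K C D a b a' b') z = H z"
    unfolding frequently_def using filterlim_iff by fastforce
  moreover have "of_real m \<in> ball (complex_of_real c) r"
    using m sub ball by blast
  ultimately have "remove_sings (Gamma_quotient J K C D a b a' b') z = H z"
    if "z \<in> ball (of_real c) r" for z
    using remove_sings_identity[OF meromorphic_on_Gamma_quotient[OF D] H open_ball connected_ball _ _ that]
    by blast
  then have "\<forall>s\<in>{c - r<..<c + r}. of_real (f s) = remove_sings (Gamma_quotient J K C D a b a' b') (of_real s)"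
    using f ball by metis
  then show ?thesis
    using D a by (intro Gamma_type_onI[where J = J and K = K and a = a and a' = a']) auto
qed

section \<open>Finiteness and analyticity of moments\<close>

lemma powr_sum_bound:
  fixes x :: real
  assumes "0 < x" "l \<le> s" "s \<le> u"
  shows "x powr s \<le> x powr l + x powr u"
proof (cases "x \<le> 1")
  case True
  then have "x powr s \<le> x powr l" using assms by (intro powr_mono') auto
  then show ?thesis by (simp add: add_increasing2)
next
  case False
  then have "x powr s \<le> x powr u" using assms by (intro powr_mono) auto
  then show ?thesis by (simp add: add_increasing)
qed

lemma moment_finite_between:
  assumes X: "positive_random_variable M X"
    and "moment M X l < \<infinity>" "moment M X u < \<infinity>" "l \<le> s" "s \<le> u"
  shows "moment M X s < \<infinity>"
proof -
  have [measurable]: "X \<in> borel_measurable M" and pos: "AE \<omega> in M. 0 < X \<omega>"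
    using X by (auto simp: positive_random_variable_def)
  have "moment M X s \<le> (\<integral>\<^sup>+\<omega>. ennreal (X \<omega> powr l) + ennreal (X \<omega> powr u) \<partial>M)"
    unfolding moment_def
  proof (rule nn_integral_mono_AE)
    show "AE \<omega> in M. ennreal (X \<omega> powr s) \<le> ennreal (X \<omega> powr l) + ennreal (X \<omega> powr u)"
      using pos
    proof eventually_elim
      case (elim \<omega>)
      then have "ennreal (X \<omega> powr s) \<le> ennreal (X \<omega> powr l + X \<omega> powr u)"
        by (intro ennreal_leI powr_sum_bound assms)
      then show ?case by simp
    qed
  qed
  also have "\<dots> = moment M X l + moment M X u"
    unfolding moment_def by (rule nn_integral_add) auto
  also have "\<dots> < \<infinity>" using assms by simp
  finally show ?thesis .
qed

lemma moment_0:
  assumes "positive_random_variable M X"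
  shows "moment M X 0 < \<infinity>"
proof -
  interpret prob_space M using assms by (simp add: positive_random_variable_def)
  have "moment M X 0 \<le> (\<integral>\<^sup>+\<omega>. 1 \<partial>M)"
    unfolding moment_def by (intro nn_integral_mono) (auto simp: powr_def)
  also have "\<dots> < \<infinity>" by (simp add: emeasure_space_1)
  finally show ?thesis .
qed

lemma integrable_powr_iff_moment:
  assumes "X \<in> borel_measurable M"
  shows "integrable M (\<lambda>\<omega>. X \<omega> powr s) \<longleftrightarrow> moment M X s < \<infinity>"
  using assms by (simp add: integrable_iff_bounded moment_def)

lemma enn2real_moment:
  assumes "X \<in> borel_measurable M"
  shows "enn2real (moment M X s) = (\<integral>\<omega>. X \<omega> powr s \<partial>M)"
  using assms by (simp add: integral_eq_nn_integral moment_def)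

text \<open>According to the sign of ln x, the left side equals one of the two summands. This
  provides the integrable majorant for the exponential series in ln X.\<close>

lemma powr_mult_exp_abs_ln_le:
  fixes x :: real
  assumes "0 < x"
  shows "x powr c * exp (r * \<bar>ln x\<bar>) \<le> x powr (c - r) + x powr (c + r)"
proof (cases "0 \<le> ln x")
  case True
  then have "x powr c * exp (r * \<bar>ln x\<bar>) = x powr (c + r)"
    using assms by (simp add: powr_def distrib_right exp_add)
  then show ?thesis by simp
next
  case False
  then have "x powr c * exp (r * \<bar>ln x\<bar>) = x powr (c - r)"
    using assms by (simp add: powr_def left_diff_distrib exp_diff exp_minus divide_inverse)
  then show ?thesis by simp
qed

text \<open>Expanding \<open>X\<close> to the power \<open>z\<close> around the centre \<open>c\<close> gives an exponential series in \<open>ln X\<close>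
  whose absolute values sum to at most \<open>X\<close> to the power \<open>c + \<rho>\<close> plus \<open>X\<close> to the power \<open>c - \<rho>\<close>,
  so it may be integrated termwise.\<close>

lemma moment_holomorphic:
  assumes X: "positive_random_variable M X"
    and fin: "\<And>s. s \<in> {c - r<..<c + r} \<Longrightarrow> moment M X s < \<infinity>"
  obtains H where "H holomorphic_on ball (of_real c) r"
    and "\<And>s. s \<in> {c - r<..<c + r} \<Longrightarrow> H (of_real s) = of_real (enn2real (moment M X s))"
proof -
  have [measurable]: "X \<in> borel_measurable M" and pos: "AE \<omega> in M. 0 < X \<omega>"
    using X by (auto simp: positive_random_variable_def)
  \<comment> \<open>The powers of z - c stay outside \<open>h\<close>, so that integrating termwise
    produces a power series around c.\<close>
  define h where "h n \<omega> = complex_of_real (X \<omega> powr c * ln (X \<omega>) ^ n / fact n)" for n \<omega>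
  define H where "H z = (\<integral>\<omega>. of_real (X \<omega> powr c) * exp (of_real (ln (X \<omega>)) * (z - of_real c)) \<partial>M)"
    for z :: complex
  have [measurable]: "h n \<in> borel_measurable M" for n
    unfolding h_def by measurable
  have sums: "(\<lambda>n. (\<integral>\<omega>. h n \<omega> \<partial>M) * (z - of_real c) ^ n) sums H z"
    if z: "z \<in> ball (of_real c) r" for z
  proof -
    \<comment> \<open>As \<rho> < r, both orders c - \<rho> and c + \<rho> lie in the interval of
      finite moments, which makes the majorant \<open>?B\<close> integrable.\<close>
    define \<rho> where "\<rho> = norm (z - of_real c)"
    have \<rho>: "0 \<le> \<rho>" "\<rho> < r"
      using z by (auto simp: \<rho>_def dist_norm norm_minus_commute)
    let ?f = "\<lambda>n \<omega>. h n \<omega> * (z - of_real c) ^ n"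
    let ?B = "\<lambda>\<omega>. X \<omega> powr (c - \<rho>) + X \<omega> powr (c + \<rho>)"
    have norm_f: "norm (?f n \<omega>) = X \<omega> powr c * ((\<rho> * \<bar>ln (X \<omega>)\<bar>) ^ n / fact n)" for n \<omega>
      unfolding h_def \<rho>_def norm_mult norm_of_real norm_power power_mult_distrib
      by (simp add: abs_mult power_abs)
    have norm_sums: "(\<lambda>n. norm (?f n \<omega>)) sums (X \<omega> powr c * exp (\<rho> * \<bar>ln (X \<omega>)\<bar>))" for \<omega>
      unfolding norm_f
      by (intro sums_mult) (use exp_converges[of "\<rho> * \<bar>ln (X \<omega>)\<bar>"] in \<open>simp only: real_scaleR_def divide_inverse_commute\<close>)
    have B: "integrable M ?B"
    proof (rule Bochner_Integration.integrable_add)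
      have "c - \<rho> \<in> {c - r<..<c + r}" "c + \<rho> \<in> {c - r<..<c + r}"
        using \<rho> by auto
      then show "integrable M (\<lambda>\<omega>. X \<omega> powr (c - \<rho>))" "integrable M (\<lambda>\<omega>. X \<omega> powr (c + \<rho>))"
        using fin \<open>X \<in> borel_measurable M\<close> integrable_powr_iff_moment by blast+
    qed
    \<comment> \<open>The bound on partial sums serves twice: for the integrability of each term,
      and for the summability of the integrals of the norms.\<close>
    have sum_le: "AE \<omega> in M. (\<Sum>n<k. norm (?f n \<omega>)) \<le> ?B \<omega>" for k
      using pos
    proof eventually_elim
      case (elim \<omega>)
      have "(\<Sum>n<k. norm (?f n \<omega>)) \<le> X \<omega> powr c * exp (\<rho> * \<bar>ln (X \<omega>)\<bar>)"
        using norm_sums[of \<omega>] sum_le_suminf[of "\<lambda>n. norm (?f n \<omega>)" "{..<k}"] unfolding sums_iff by simp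
      also have "\<dots> \<le> ?B \<omega>"
        using elim by (rule powr_mult_exp_abs_ln_le)
      finally show ?case .
    qed
    have integrable: "integrable M (?f n)" for n
    proof (rule Bochner_Integration.integrable_bound[OF B])
      show "AE \<omega> in M. norm (?f n \<omega>) \<le> norm (?B \<omega>)"
        using sum_le[of "Suc n"]
      proof eventually_elim
        case (elim \<omega>)
        have "norm (?f n \<omega>) \<le> (\<Sum>n<Suc n. norm (?f n \<omega>))"
          by (simp add: sum_nonneg)
        with elim show ?case by simp
      qed
    qed simp
    have "summable (\<lambda>n. \<integral>\<omega>. norm (?f n \<omega>) \<partial>M)"
    proof (rule summableI_nonneg_bounded)
      fix k
      have "(\<Sum>n<k. \<integral>\<omega>. norm (?f n \<omega>) \<partial>M) = (\<integral>\<omega>. (\<Sum>n<k. norm (?f n \<omega>)) \<partial>M)"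
        by (intro Bochner_Integration.integral_sum[symmetric] integrable_norm integrable)
      also have "\<dots> \<le> (\<integral>\<omega>. ?B \<omega> \<partial>M)"
        by (intro integral_mono_AE sum_le B Bochner_Integration.integrable_sum integrable_norm integrable)
      finally show "(\<Sum>n<k. \<integral>\<omega>. norm (?f n \<omega>) \<partial>M) \<le> (\<integral>\<omega>. ?B \<omega> \<partial>M)" .
    qed simp
    then have "(\<lambda>n. \<integral>\<omega>. ?f n \<omega> \<partial>M) sums (\<integral>\<omega>. (\<Sum>n. ?f n \<omega>) \<partial>M)"
      using norm_sums by (intro sums_integral integrable AE_I2) (auto simp: sums_iff)
    moreover have "(\<Sum>n. ?f n \<omega>) = of_real (X \<omega> powr c) * exp (of_real (ln (X \<omega>)) * (z - of_real c))"
      for \<omega>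
    proof -
      have "(\<lambda>n. of_real (X \<omega> powr c) * ((of_real (ln (X \<omega>)) * (z - of_real c)) ^ n /\<^sub>R fact n)) sums
          (of_real (X \<omega> powr c) * exp (of_real (ln (X \<omega>)) * (z - of_real c)))"
        by (intro sums_mult exp_converges)
      then show ?thesis
        unfolding sums_iff h_def power_mult_distrib by (simp add: scaleR_conv_of_real divide_inverse mult_ac)
    qed
    ultimately show ?thesis
      by (simp add: H_def)
  qed
  have "H holomorphic_on ball (of_real c) r"
    using sums by (rule power_series_holomorphic)
  moreover have "H (of_real s) = of_real (enn2real (moment M X s))" for s
  proof -
    have "H (of_real s) = (\<integral>\<omega>. of_real (X \<omega> powr s) \<partial>M)"
      unfolding H_def
    proof (rule integral_cong_AE)
      show "AE \<omega> in M. complex_of_real (X \<omega> powr c) * exp (of_real (ln (X \<omega>)) * (of_real s - of_real c)) =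
          of_real (X \<omega> powr s)"
        using pos
      proof eventually_elim
        case (elim \<omega>)
        have "X \<omega> powr c * exp (ln (X \<omega>) * (s - c)) = X \<omega> powr s"
          using elim by (simp add: powr_def algebra_simps flip: exp_add)
        then show ?case
          by (metis exp_of_real of_real_diff of_real_mult)
      qed
    qed measurable
    then show ?thesis
      by (simp add: enn2real_moment)
  qed
  ultimately show ?thesis using that by blast
qed

text \<open>The order r of Z corresponds to the order - \<alpha> * r of V, which exceeds - \<alpha>
  exactly when r < 1. This explains the threshold 1 for l.\<close>

lemma moments_of_Gamma_type_near_0:
  assumes X: "positive_random_variable M X" and G: "moments_of_Gamma_type M X"
  obtains l u where "l < u" "l < 1" "\<And>s. s \<in> {l<..<u} \<Longrightarrow> moment M X s < \<infinity>"
    "Gamma_type_on {l<..<u} (\<lambda>s. enn2real (moment M X s))"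
proof -
  from G obtain l u where lu: "l < u" and fin: "\<And>s. s \<in> {l<..<u} \<Longrightarrow> moment M X s < \<infinity>"
    and GT: "Gamma_type_on {l<..<u} (\<lambda>s. enn2real (moment M X s))"
    unfolding moments_of_Gamma_type_iff by blast
  show thesis
  proof (cases "l < 1")
    case True
    from that[OF lu this fin GT] show thesis .
  next
    case False
    have fin': "moment M X s < \<infinity>" if "s \<in> {0<..<u}" for s
    proof (cases "l < s")
      case True
      then show ?thesis using that fin by simp
    next
      case F: False
      \<comment> \<open>An order s in (0, l] lies between the orders 0 and (l + u) / 2, whose
        moments are both finite.\<close>
      have "moment M X ((l + u) / 2) < \<infinity>"
        using lu by (intro fin) auto
      from moment_finite_between[OF X moment_0[OF X] this] show ?thesis
        using F that lu by simp
    qed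
    \<comment> \<open>The disc with centre and radius u / 2 has (0, u) as its real diameter.\<close>
    have disc: "{u / 2 - u / 2<..<u / 2 + u / 2} = {0<..<u}" by auto
    obtain H where H: "H holomorphic_on ball (of_real (u / 2)) (u / 2)"
      "\<And>s. s \<in> {u / 2 - u / 2<..<u / 2 + u / 2} \<Longrightarrow> H (of_real s) = of_real (enn2real (moment M X s))"
    proof (rule moment_holomorphic[OF X, of "u / 2" "u / 2"])
      show "moment M X s < \<infinity>" if "s \<in> {u / 2 - u / 2<..<u / 2 + u / 2}" for s
        using that unfolding disc by (rule fin')
    qed (rule that)
    have "{l<..<u} \<subseteq> {u / 2 - u / 2<..<u / 2 + u / 2}"
      unfolding disc using False by auto
    from Gamma_type_on_ball[OF GT lu H this]
    have "Gamma_type_on {0<..<u} (\<lambda>s. enn2real (moment M X s))"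
      unfolding disc .
    moreover have "0 < u"
      using False lu by simp
    ultimately show thesis
      using that[of 0 u] fin' by simp
  qed
qed

section \<open>Return from laws to the random variables\<close>

lemma moment_eq_nn_integral_distr:
  assumes [measurable]: "X \<in> borel_measurable M"
  shows "moment M X s = (\<integral>\<^sup>+x. ennreal (x powr s) \<partial>distr M borel X)"
  unfolding moment_def by (subst nn_integral_distr) auto

text \<open>Needed because infinity times 0 is 0 in \<open>ennreal\<close>: a divergent exponential
  factor must not be lost in the product.\<close>

lemma moment_pos:
  assumes "positive_random_variable M X"
  shows "0 < moment M X s"
proof -
  have [measurable]: "X \<in> borel_measurable M" and pos: "AE \<omega> in M. 0 < X \<omega>"
    using assms by (auto simp: positive_random_variable_def)
  interpret prob_space M
    using assms by (simp add: positive_random_variable_def)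
  have "moment M X s \<noteq> 0"
  proof
    assume "moment M X s = 0"
    then have "AE \<omega> in M. ennreal (X \<omega> powr s) = 0"
      unfolding moment_def by (subst (asm) nn_integral_0_iff_AE) auto
    with pos have "AE \<omega> in M. False"
      by eventually_elim (simp add: ennreal_eq_0_iff)
    then show False by (simp add: AE_False)
  qed
  then show ?thesis by (simp add: zero_less_iff_neq_zero)
qed

lemma positive_law_distr:
  assumes "positive_random_variable N Z" "0 < \<alpha>"
  shows "positive_law (distr N borel Z) \<alpha>"
proof (rule positive_law.intro)
  interpret prob_space N
    using assms by (simp add: positive_random_variable_def)
  have [measurable]: "Z \<in> borel_measurable N" and pos: "AE \<omega> in N. 0 < Z \<omega>"
    using assms by (auto simp: positive_random_variable_def)
  show "real_distribution (distr N borel Z)"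
    by (rule real_distribution_distr) measurable
  show "AE z in distr N borel Z. 0 < z"
    using pos by (subst AE_distr_iff) auto
qed fact

lemma tail_is_Laplace_iff:
  assumes V: "positive_random_variable M V" and Z: "positive_random_variable N Z" and "0 < \<alpha>"
  shows "tail_is_Laplace M V N Z \<alpha> \<longleftrightarrow> distr M borel V = exp_ratio_law \<alpha> (distr N borel Z)"
proof -
  \<comment> \<open>The exponent 1 is an arbitrary positive value; the interpretation supplies
    positivity and the distribution property for the law of V.\<close>
  interpret V: positive_law "distr M borel V" 1
    using V by (rule positive_law_distr) simp
  interpret Z: positive_law "distr N borel Z" \<alpha>
    using Z \<open>0 < \<alpha>\<close> by (rule positive_law_distr)
  have [measurable]: "V \<in> borel_measurable M" "Z \<in> borel_measurable N"
    using V Z by (auto simp: positive_random_variable_def)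
  have "tail_is_Laplace M V N Z \<alpha> \<longleftrightarrow>
      (\<forall>x>0. measure (distr M borel V) {x<..} = measure (exp_ratio_law \<alpha> (distr N borel Z)) {x<..})"
    unfolding tail_is_Laplace_def
    by (simp add: measure_distr Z.measure_exp_ratio_law_greaterThan integral_distr vimage_def Int_def conj_commute)
  also have "\<dots> \<longleftrightarrow> distr M borel V = exp_ratio_law \<alpha> (distr N borel Z)"
    using real_distribution_eqI_tails[OF V.real_distribution Z.real_distribution_exp_ratio_law
        V.AE_pos Z.AE_exp_ratio_law_pos] by auto
  finally show ?thesis .
qed

text \<open>By independence the joint law of T and Z' is the product of their laws, and Z' has the
  law of Z.\<close>

lemma distr_exp_ratio:
  assumes "exp_independent_of Q T Z' N Z"
  shows "distr Q borel (\<lambda>\<omega>. T \<omega> powr (1 / \<alpha>) / Z' \<omega> powr (1 / \<alpha>)) = exp_ratio_law \<alpha> (distr N borel Z)"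
proof -
  interpret prob_space Q
    using assms by (simp add: exp_independent_of_def)
  have T: "distributed Q lborel T (exponential_density 1)"
    and [measurable]: "Z' \<in> borel_measurable Q"
    and Z': "distr Q borel Z' = distr N borel Z"
    and indep: "indep_var borel T borel Z'"
    using assms by (auto simp: exp_independent_of_def same_distribution_def)
  have [measurable]: "T \<in> borel_measurable Q"
    using T by (auto simp: distributed_def)
  have "distr Q borel T = distr Q lborel T"
    by (rule distr_cong) auto
  also have "\<dots> = exp_law"
    using T by (simp add: distributed_distr_eq_density exp_law_def)
  finally have joint: "exp_law \<Otimes>\<^sub>M distr N borel Z = distr Q (borel \<Otimes>\<^sub>M borel) (\<lambda>\<omega>. (T \<omega>, Z' \<omega>))"
    using indep Z' by (simp add: indep_var_distribution_eq)
  show ?thesis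
    unfolding exp_ratio_law_def joint by (subst distr_distr) (auto simp: o_def)
qed

lemma
  assumes V: "positive_random_variable M V" and Z: "positive_random_variable N Z" and "0 < \<alpha>"
    and law: "distr M borel V = exp_ratio_law \<alpha> (distr N borel Z)"
  shows moment_exp_ratio: "- \<alpha> < s \<Longrightarrow> moment M V s = ennreal (Gamma (s / \<alpha> + 1)) * moment N Z (- s / \<alpha>)"
    and moment_exp_ratio_top: "s \<le> - \<alpha> \<Longrightarrow> moment M V s = \<infinity>"
proof -
  interpret Z: positive_law "distr N borel Z" \<alpha>
    using Z \<open>0 < \<alpha>\<close> by (rule positive_law_distr)
  have [measurable]: "V \<in> borel_measurable M" "Z \<in> borel_measurable N"
    using V Z by (auto simp: positive_random_variable_def)
  have eq: "moment M V s = (\<integral>\<^sup>+t. ennreal (t powr (s / \<alpha>)) \<partial>exp_law) * moment N Z (- s / \<alpha>)"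
    by (simp add: moment_eq_nn_integral_distr law Z.nn_integral_exp_ratio_law_powr)
  show "moment M V s = ennreal (Gamma (s / \<alpha> + 1)) * moment N Z (- s / \<alpha>)" if "- \<alpha> < s"
    using that \<open>0 < \<alpha>\<close> unfolding eq by (subst nn_integral_exp_law_powr) (auto simp: field_simps)
  show "moment M V s = \<infinity>" if "s \<le> - \<alpha>"
    using that \<open>0 < \<alpha>\<close> moment_pos[OF Z, of "- s / \<alpha>"] unfolding eq
    by (subst nn_integral_exp_law_powr_top) (auto simp: field_simps ennreal_top_mult)
qed

text \<open>From Z to V, rescale by - 1 / \<alpha> and multiply by Gamma (s / \<alpha> + 1). From V
  to Z, rescale by - \<alpha> and divide by the same factor, which reads Gamma (1 - r) at s = -
  \<alpha> * r.\<close>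

lemma moments_of_Gamma_type_exp_ratio:
  assumes V: "positive_random_variable M V" and Z: "positive_random_variable N Z" and \<alpha>: "0 < \<alpha>"
    and law: "distr M borel V = exp_ratio_law \<alpha> (distr N borel Z)"
  shows "moments_of_Gamma_type N Z \<longleftrightarrow> moments_of_Gamma_type M V"
proof
  note moment = moment_exp_ratio[OF V Z \<alpha> law]
  have Gamma_pos: "0 < Gamma (s / \<alpha> + 1)" if "- \<alpha> < s" for s
    using that \<alpha> by (intro Gamma_real_pos) (simp add: field_simps)
  {
    assume "moments_of_Gamma_type N Z"
    then obtain l u where lu: "l < u" "l < 1"
      and fin: "\<And>s. s \<in> {l<..<u} \<Longrightarrow> moment N Z s < \<infinity>"
      and G: "Gamma_type_on {l<..<u} (\<lambda>s. enn2real (moment N Z s))"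
      using moments_of_Gamma_type_near_0[OF Z] by metis
    \<comment> \<open>This is the image of (l, min u 1) under multiplication by - \<alpha>. The cap
      at 1 ensures s > - \<alpha>, and l < 1 keeps the interval nonempty.\<close>
    define l' u' where "l' = - \<alpha> * min u 1" and "u' = - \<alpha> * l"
    have in_range: "- \<alpha> < s" "(- 1 / \<alpha>) * s \<in> {l<..<u}" if "s \<in> {l'<..<u'}" for s
    proof -
      have s: "- \<alpha> * min u 1 < s" "s < - \<alpha> * l"
        using that by (auto simp: l'_def u'_def)
      have "\<alpha> * min u 1 \<le> \<alpha>" "\<alpha> * min u 1 \<le> \<alpha> * u"
        using \<alpha> by (auto simp: min_def)
      with s have "- \<alpha> < s" "- \<alpha> * u < s" by auto
      then show "- \<alpha> < s" "(- 1 / \<alpha>) * s \<in> {l<..<u}"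
        using \<alpha> s(2) by (auto simp: field_simps)
    qed
    have m: "moment M V s = ennreal (Gamma (s / \<alpha> + 1)) * moment N Z ((- 1 / \<alpha>) * s)"
      if "s \<in> {l'<..<u'}" for s
      using moment in_range(1)[OF that] by simp
    have "Gamma_type_on {l'<..<u'} (\<lambda>s. Gamma ((1 / \<alpha>) * s + 1) * enn2real (moment N Z ((- 1 / \<alpha>) * s)))"
    proof (rule Gamma_type_on_mult_Gamma)
      show "Gamma_type_on {l'<..<u'} (\<lambda>s. enn2real (moment N Z ((- 1 / \<alpha>) * s)))"
        using \<alpha> in_range(2) by (intro Gamma_type_on_scale[OF G]) auto
      show "0 < 1 / \<alpha> * s + 1" if "s \<in> {l'<..<u'}" for s
        using in_range(1)[OF that] \<alpha> by (simp add: field_simps)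
    qed (use \<alpha> in simp)
    moreover have "enn2real (moment M V s) = Gamma ((1 / \<alpha>) * s + 1) * enn2real (moment N Z ((- 1 / \<alpha>) * s))"
      if "s \<in> {l'<..<u'}" for s
      using Gamma_pos[OF in_range(1)[OF that]] by (simp add: m[OF that] enn2real_mult)
    ultimately have "Gamma_type_on {l'<..<u'} (\<lambda>s. enn2real (moment M V s))"
      by (subst Gamma_type_on_cong) auto
    moreover have "moment M V s < \<infinity>" if "s \<in> {l'<..<u'}" for s
      using fin[OF in_range(2)[OF that]] by (simp add: m[OF that] ennreal_mult_less_top)
    moreover have "l' < u'"
      using lu \<alpha> by (simp add: l'_def u'_def)
    ultimately show "moments_of_Gamma_type M V"
      unfolding moments_of_Gamma_type_iff by blast
  next
    assume "moments_of_Gamma_type M V"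
    then obtain l u where lu: "l < u"
      and fin: "\<And>s. s \<in> {l<..<u} \<Longrightarrow> moment M V s < \<infinity>"
      and G: "Gamma_type_on {l<..<u} (\<lambda>s. enn2real (moment M V s))"
      unfolding moments_of_Gamma_type_iff by blast
    \<comment> \<open>No shrinking is necessary in this direction, since finite moments of V can
      only occur at orders above - \<alpha>.\<close>
    have above: "- \<alpha> < s" if "s \<in> {l<..<u}" for s
      using fin[OF that] moment_exp_ratio_top[OF V Z \<alpha> law, of s] by force
    define l' u' where "l' = - u / \<alpha>" and "u' = - l / \<alpha>"
    have in_range: "- \<alpha> * r \<in> {l<..<u}" if "r \<in> {l'<..<u'}" for r
      using that \<alpha> by (auto simp: l'_def u'_def field_simps)
    have m: "moment M V (- \<alpha> * r) = ennreal (Gamma (- 1 * r + 1)) * moment N Z r"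
      and pos: "0 < - 1 * r + 1" "0 < Gamma (- 1 * r + 1)"
      if "r \<in> {l'<..<u'}" for r
    proof -
      have "- \<alpha> < - \<alpha> * r"
        using above in_range that by blast
      from moment[OF this] Gamma_pos[OF this]
      show "moment M V (- \<alpha> * r) = ennreal (Gamma (- 1 * r + 1)) * moment N Z r"
        "0 < Gamma (- 1 * r + 1)"
        using \<alpha> by auto
      show "0 < - 1 * r + 1"
        using \<open>- \<alpha> < - \<alpha> * r\<close> \<alpha> by simp
    qed
    have "Gamma_type_on {l'<..<u'} (\<lambda>r. enn2real (moment M V (- \<alpha> * r)) / Gamma (- 1 * r + 1))"
      using \<alpha> in_range pos
      by (intro Gamma_type_on_divide_Gamma Gamma_type_on_scale[OF G, where c = "- \<alpha>"]) auto
    moreover have "enn2real (moment M V (- \<alpha> * r)) / Gamma (- 1 * r + 1) = enn2real (moment N Z r)"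
      if "r \<in> {l'<..<u'}" for r
      using less_imp_neq[OF pos(2)[OF that]] pos(2)[OF that]
      unfolding m[OF that] enn2real_mult by simp
    ultimately have "Gamma_type_on {l'<..<u'} (\<lambda>r. enn2real (moment N Z r))"
      by (subst (asm) Gamma_type_on_cong) auto
    \<comment> \<open>The Gamma factor is positive, so a finite product forces the moment of Z to be
      finite.\<close>
    moreover have "moment N Z r < \<infinity>" if "r \<in> {l'<..<u'}" for r
      using fin[OF in_range[OF that]] pos(2)[OF that] less_imp_neq[OF pos(2)[OF that]]
      unfolding m[OF that] by (auto simp: ennreal_mult_less_top)
    moreover have "l' < u'"
      using lu \<alpha> by (simp add: l'_def u'_def divide_strict_right_mono)
    ultimately show "moments_of_Gamma_type N Z"
      unfolding moments_of_Gamma_type_iff by blast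
  }
qed

theorem lemma1p11:
  fixes M :: "'a measure" and V :: "'a \<Rightarrow> real"
    and N :: "'b measure" and Z :: "'b \<Rightarrow> real"
    and Q :: "'c measure" and T Z' :: "'c \<Rightarrow> real"
    and \<alpha> :: real
  assumes "positive_random_variable M V"
    and "positive_random_variable N Z"
    and "\<alpha> > 0"
  shows
    "(exp_independent_of Q T Z' N Z \<longrightarrow>
       (tail_is_Laplace M V N Z \<alpha> \<longleftrightarrow>
        same_distribution M V Q (\<lambda>\<omega>. T \<omega> powr (1 / \<alpha>) / Z' \<omega> powr (1 / \<alpha>)))) \<and>
     (tail_is_Laplace M V N Z \<alpha> \<or>
      (exp_independent_of Q T Z' N Z \<and>
       same_distribution M V Q (\<lambda>\<omega>. T \<omega> powr (1 / \<alpha>) / Z' \<omega> powr (1 / \<alpha>))) \<longrightarrow>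
       (\<forall>s. s > - \<alpha> \<longrightarrow>
          moment M V s = ennreal (Gamma (s / \<alpha> + 1)) * moment N Z (- s / \<alpha>)) \<and>
       (moments_of_Gamma_type N Z \<longleftrightarrow> moments_of_Gamma_type M V))"
  \<comment> \<open>Either form of the hypothesis says that the law of V is
    \<open>exp_ratio_law\<close> of the law of Z, which is all that the moment statements
    require.\<close>
  using tail_is_Laplace_iff[OF assms] moment_exp_ratio[OF assms] moments_of_Gamma_type_exp_ratio[OF assms]
  by (auto simp: same_distribution_def distr_exp_ratio)

end
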